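(* Let $g$ be a smooth vector field on $\mathbb{R}^n$ and $\omega$ a smooth 1-form on $\mathbb{R}^n$ with $\omega(g)\neq0$ everywhere and $d\omega\wedge\omega=0$. For all sections $\bar m_1,\bar m_2$ of the quotient bundle $T\mathbb{R}^n/\mathrm{span}(g)$ and all $\alpha\in C^\infty(\mathbb{R}^n)$, $$\langle\bar m_1,\alpha\bar m_2\rangle=\alpha\langle\bar m_1,\bar m_2\rangle+\big(\mathrm{an}_{\omega,g}(\bar m_1)(\alpha)\big)\,\bar m_2 .$$
   Context: A section $\bar m$ of $T\mathbb{R}^n/\mathrm{span}(g)$ is the class of a smooth vector field $m$ on $\mathbb{R}^n$ modulo $\{\alpha g:\alpha\in C^\infty(\mathbb{R}^n)\}$. The bracket $\langle\bar m_1,\bar m_2\rangle$ is the class of $$\langle m_1,m_2\rangle=[m_1,m_2]+\frac{\omega(m_2)}{\omega(g)}[g,m_1]-\frac{\omega(m_1)}{\omega(g)}[g,m_2],$$ which is independent of the representatives $m_1,m_2$. Here $[\cdot,\cdot]$ is the usual Lie bracket of vector fields. The anchor is $\mathrm{an}_{\omega,g}(\bar m):=m-\frac{\omega(m)}{\omega(g)}g$, a vector field on $\mathbb{R}^n$ independent of the representative $m$; $\mathrm{an}_{\omega,g}(\bar m)(\alpha)$ is its derivative applied to $\alpha$. *)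

theory Defs
  imports "HOL-Analysis.Analysis"
begin

section \<open>Smooth maps\<close>

text \<open>
  On a finite-dimensional domain, \<^term>\<open>C_diff k f\<close> says that all iterated directional
  derivatives of \<^term>\<open>f\<close> of order less than \<^term>\<open>k\<close> are differentiable, and those of
  order \<^term>\<open>k\<close> are continuous, that is, \<^term>\<open>f\<close> is of class $C^k$.
\<close>

primrec C_diff :: "nat \<Rightarrow> ('a::real_normed_vector \<Rightarrow> 'b::real_normed_vector) \<Rightarrow> bool" where
  "C_diff 0 f \<longleftrightarrow> continuous_on UNIV f"
| "C_diff (Suc k) f \<longleftrightarrow>
    (\<forall>x. f differentiable (at x)) \<and>
    (\<forall>v. C_diff k (\<lambda>x. frechet_derivative f (at x) v))"

definition smooth :: "('a::real_normed_vector \<Rightarrow> 'b::real_normed_vector) \<Rightarrow> bool" where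
  "smooth f \<longleftrightarrow> (\<forall>k. C_diff k f)"


section \<open>Vector fields and differential forms\<close>

type_synonym 'n vfield = "real^'n \<Rightarrow> real^'n"
type_synonym 'n one_form = "real^'n \<Rightarrow> ((real^'n) \<Rightarrow>\<^sub>L real)"
type_synonym 'n two_form = "real^'n \<Rightarrow> real^'n \<Rightarrow> real^'n \<Rightarrow> real"
type_synonym 'n three_form = "real^'n \<Rightarrow> real^'n \<Rightarrow> real^'n \<Rightarrow> real^'n \<Rightarrow> real"

definition apply_vf :: "'n::finite vfield \<Rightarrow> (real^'n \<Rightarrow> real) \<Rightarrow> real^'n \<Rightarrow> real" where
  "apply_vf X \<alpha> = (\<lambda>x. frechet_derivative \<alpha> (at x) (X x))"

text \<open>The sign is such that $[X,Y](\alpha) = X(Y(\alpha)) - Y(X(\alpha))$.\<close>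

definition lie_bracket :: "'n::finite vfield \<Rightarrow> 'n vfield \<Rightarrow> 'n vfield" where
  "lie_bracket X Y =
    (\<lambda>x. frechet_derivative Y (at x) (X x) - frechet_derivative X (at x) (Y x))"

definition pairing :: "'n::finite one_form \<Rightarrow> 'n vfield \<Rightarrow> real^'n \<Rightarrow> real" where
  "pairing \<omega> X = (\<lambda>x. blinfun_apply (\<omega> x) (X x))"

text \<open>
  With $\omega = \sum_j \omega_j\,dx_j$ this is
  $d\omega = \sum_{i<j} (\partial_i\omega_j - \partial_j\omega_i)\,dx_i \wedge dx_j$.
\<close>

definition ext_deriv :: "'n::finite one_form \<Rightarrow> 'n two_form" where
  "ext_deriv \<omega> = (\<lambda>x u v.
    blinfun_apply (frechet_derivative \<omega> (at x) u) v -
    blinfun_apply (frechet_derivative \<omega> (at x) v) u)"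

text \<open>The sum over the three (2,1)-shuffles.\<close>

definition wedge_2_1 :: "'n::finite two_form \<Rightarrow> 'n one_form \<Rightarrow> 'n three_form" where
  "wedge_2_1 \<eta> \<omega> = (\<lambda>x u v w.
    \<eta> x u v * blinfun_apply (\<omega> x) w
    - \<eta> x u w * blinfun_apply (\<omega> x) v
    + \<eta> x v w * blinfun_apply (\<omega> x) u)"


section \<open>Sections of the quotient bundle\<close>

definition span_rel :: "'n::finite vfield \<Rightarrow> ('n vfield \<times> 'n vfield) set" where
  "span_rel g = {(m, m'). smooth m \<and> smooth m' \<and>
    (\<exists>\<alpha>. smooth \<alpha> \<and> m' = (\<lambda>x. m x + \<alpha> x *\<^sub>R g x))}"

definition sec_class :: "'n::finite vfield \<Rightarrow> 'n vfield \<Rightarrow> 'n vfield set" where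
  "sec_class g m = span_rel g `` {m}"

definition sections :: "'n::finite vfield \<Rightarrow> 'n vfield set set" where
  "sections g = {m. smooth m} // span_rel g"

text \<open>
  Operations on sections are the union of the classes of the results over all
  representatives, as usual for functions respecting an equivalence relation.
\<close>

definition sec_add ::
  "'n::finite vfield \<Rightarrow> 'n vfield set \<Rightarrow> 'n vfield set \<Rightarrow> 'n vfield set" where
  "sec_add g M N = (\<Union>m\<in>M. \<Union>n\<in>N. sec_class g (\<lambda>x. m x + n x))"

definition sec_scale ::
  "'n::finite vfield \<Rightarrow> (real^'n \<Rightarrow> real) \<Rightarrow> 'n vfield set \<Rightarrow> 'n vfield set" where
  "sec_scale g \<alpha> M = (\<Union>m\<in>M. sec_class g (\<lambda>x. \<alpha> x *\<^sub>R m x))"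

definition vf_bracket ::
  "'n::finite one_form \<Rightarrow> 'n vfield \<Rightarrow> 'n vfield \<Rightarrow> 'n vfield \<Rightarrow> 'n vfield" where
  "vf_bracket \<omega> g m1 m2 = (\<lambda>x.
    lie_bracket m1 m2 x
    + (pairing \<omega> m2 x / pairing \<omega> g x) *\<^sub>R lie_bracket g m1 x
    - (pairing \<omega> m1 x / pairing \<omega> g x) *\<^sub>R lie_bracket g m2 x)"

definition sec_bracket ::
  "'n::finite one_form \<Rightarrow> 'n vfield \<Rightarrow> 'n vfield set \<Rightarrow> 'n vfield set \<Rightarrow> 'n vfield set" where
  "sec_bracket \<omega> g M1 M2 = (\<Union>m1\<in>M1. \<Union>m2\<in>M2. sec_class g (vf_bracket \<omega> g m1 m2))"

definition vf_anchor :: "'n::finite one_form \<Rightarrow> 'n vfield \<Rightarrow> 'n vfield \<Rightarrow> 'n vfield" where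
  "vf_anchor \<omega> g m = (\<lambda>x. m x - (pairing \<omega> m x / pairing \<omega> g x) *\<^sub>R g x)"

definition sec_anchor :: "'n::finite one_form \<Rightarrow> 'n vfield \<Rightarrow> 'n vfield set \<Rightarrow> 'n vfield" where
  "sec_anchor \<omega> g M = the_elem (vf_anchor \<omega> g ` M)"


section \<open>Closure properties of smooth maps\<close>

lemma C_diff_Suc_imp: "C_diff (Suc k) f \<Longrightarrow> C_diff k f"
proof (induction k arbitrary: f)
  case 0
  then show ?case
    by (auto intro!: differentiable_imp_continuous_on simp: differentiable_on_def)
next
  case (Suc k)
  then show ?case by (metis C_diff.simps(2))
qed

lemma C_diff_const: "C_diff k (\<lambda>x::'a::real_normed_vector. c::'b::real_normed_vector)"
  by (induction k arbitrary: c) simp_all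

lemma frechet_derivative_add_fun:
  assumes "\<And>x. f differentiable (at x)" "\<And>x. h differentiable (at x)"
  shows "frechet_derivative (\<lambda>x. f x + h x) (at x) v
    = frechet_derivative f (at x) v + frechet_derivative h (at x) v"
proof -
  have "((\<lambda>x. f x + h x) has_derivative
      (\<lambda>v. frechet_derivative f (at x) v + frechet_derivative h (at x) v)) (at x)"
    by (intro has_derivative_add frechet_derivative_works[THEN iffD1] assms)
  from frechet_derivative_at[OF this] show ?thesis by (rule fun_cong[symmetric])
qed

lemma C_diff_add: "C_diff k f \<Longrightarrow> C_diff k h \<Longrightarrow> C_diff k (\<lambda>x. f x + h x)"
proof (induction k arbitrary: f h)
  case 0
  then show ?case by (auto intro: continuous_on_add)
next
  case (Suc k)
  then show ?case
    by (auto simp: frechet_derivative_add_fun)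
qed

lemma frechet_derivative_bilinear_fun:
  assumes "bounded_bilinear pr"
    and "\<And>x. f differentiable (at x)" "\<And>x. h differentiable (at x)"
  shows "frechet_derivative (\<lambda>x. pr (f x) (h x)) (at x) v
    = pr (f x) (frechet_derivative h (at x) v) + pr (frechet_derivative f (at x) v) (h x)"
proof -
  have "((\<lambda>x. pr (f x) (h x)) has_derivative
      (\<lambda>v. pr (f x) (frechet_derivative h (at x) v) + pr (frechet_derivative f (at x) v) (h x))) (at x)"
    by (intro bounded_bilinear.FDERIV[OF assms(1)] frechet_derivative_works[THEN iffD1] assms)
  from frechet_derivative_at[OF this] show ?thesis by (rule fun_cong[symmetric])
qed

lemma C_diff_bilinear:
  assumes pr: "bounded_bilinear pr"
  shows "C_diff k f \<Longrightarrow> C_diff k h \<Longrightarrow> C_diff k (\<lambda>x. pr (f x) (h x))"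
proof (induction k arbitrary: f h)
  case 0
  then show ?case by (auto intro: bounded_bilinear.continuous_on[OF pr])
next
  case (Suc k)
  have d: "(\<lambda>x. pr (f x) (h x)) differentiable (at x)" for x
  proof -
    have "f differentiable (at x)" "h differentiable (at x)" using Suc.prems by simp_all
    then obtain f' h' where "(f has_derivative f') (at x)" "(h has_derivative h') (at x)"
      by (auto simp: differentiable_def)
    from bounded_bilinear.FDERIV[OF pr this] show ?thesis
      by (rule differentiableI)
  qed
  have "C_diff k f" "C_diff k h"
    using Suc.prems C_diff_Suc_imp by blast+
  then have "C_diff k (\<lambda>x. pr (f x) (frechet_derivative h (at x) v)
      + pr (frechet_derivative f (at x) v) (h x))" for v
    using Suc.prems by (intro C_diff_add Suc.IH) simp_all
  then show ?case
    using Suc.prems d by (simp add: frechet_derivative_bilinear_fun[OF pr])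
qed

lemma C_diff_inverse:
  fixes f :: "'a::real_normed_vector \<Rightarrow> real"
  assumes "\<And>x. f x \<noteq> 0"
  shows "C_diff k f \<Longrightarrow> C_diff k (\<lambda>x. inverse (f x))"
proof (induction k)
  case 0
  then show ?case using assms by (auto intro!: continuous_on_inverse)
next
  case (Suc k)
  have D: "((\<lambda>x. inverse (f x)) has_derivative
      (\<lambda>v. - (inverse (f x) * frechet_derivative f (at x) v * inverse (f x)))) (at x)" for x
    using Suc.prems assms
    by (intro Deriv.has_derivative_inverse frechet_derivative_works[THEN iffD1]) auto
  have fd: "frechet_derivative (\<lambda>x. inverse (f x)) (at x) v
      = (-1) * (inverse (f x) * frechet_derivative f (at x) v * inverse (f x))" for x v
    using fun_cong[OF frechet_derivative_at[OF D[of x]], of v] by simp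
  have "C_diff k (\<lambda>x. (-1) * (inverse (f x) * frechet_derivative f (at x) v * inverse (f x)))" for v
    using Suc.prems Suc.IH[OF C_diff_Suc_imp[OF Suc.prems]]
    by (intro C_diff_bilinear[OF bounded_bilinear_mult] C_diff_const) simp_all
  then show ?case
    using D by (auto simp: fd differentiable_def)
qed

lemma smooth_const [intro]: "smooth (\<lambda>x. c)"
  by (simp add: smooth_def C_diff_const)

lemma smooth_add [intro]: "smooth f \<Longrightarrow> smooth h \<Longrightarrow> smooth (\<lambda>x. f x + h x)"
  by (simp add: smooth_def C_diff_add)

lemma smooth_scaleR [intro]:
  "smooth f \<Longrightarrow> smooth h \<Longrightarrow> smooth (\<lambda>x. f x *\<^sub>R h x)"
  by (simp add: smooth_def C_diff_bilinear[OF bounded_bilinear_scaleR])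

lemma smooth_mult [intro]:
  fixes f :: "'a::real_normed_vector \<Rightarrow> real"
  shows "smooth f \<Longrightarrow> smooth h \<Longrightarrow> smooth (\<lambda>x. f x * h x)"
  by (simp add: smooth_def C_diff_bilinear[OF bounded_bilinear_mult])

lemma smooth_minus [intro]: "smooth f \<Longrightarrow> smooth (\<lambda>x. - f x)"
  using smooth_scaleR[OF smooth_const[of "-1"], of f] by simp

lemma smooth_diff [intro]: "smooth f \<Longrightarrow> smooth h \<Longrightarrow> smooth (\<lambda>x. f x - h x)"
  using smooth_add[OF _ smooth_minus] by fastforce

lemma smooth_divide [intro]:
  fixes f :: "'a::real_normed_vector \<Rightarrow> real"
  shows "smooth f \<Longrightarrow> smooth h \<Longrightarrow> (\<And>x. h x \<noteq> 0) \<Longrightarrow> smooth (\<lambda>x. f x / h x)"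
  by (simp add: smooth_def divide_inverse C_diff_inverse C_diff_bilinear[OF bounded_bilinear_mult])

lemma smooth_pairing [intro]: "smooth \<omega> \<Longrightarrow> smooth X \<Longrightarrow> smooth (pairing \<omega> X)"
  unfolding pairing_def
  by (simp add: smooth_def C_diff_bilinear[OF bounded_bilinear_blinfun_apply])

lemma smooth_sum [intro]:
  "(\<And>i. i \<in> I \<Longrightarrow> smooth (f i)) \<Longrightarrow> smooth (\<lambda>x. \<Sum>i\<in>I. f i x)"
  by (induction I rule: infinite_finite_induct) auto

lemma smooth_differentiable: "smooth f \<Longrightarrow> f differentiable (at x)"
  unfolding smooth_def by (metis C_diff.simps(2))

lemma smooth_has_derivative:
  "smooth f \<Longrightarrow> (f has_derivative frechet_derivative f (at x)) (at x)"
  by (simp add: smooth_differentiable frechet_derivative_works[THEN iffD1])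

lemma smooth_frechet_derivative:
  "smooth f \<Longrightarrow> smooth (\<lambda>x. frechet_derivative f (at x) v)"
  unfolding smooth_def by (metis C_diff.simps(2))

lemma linear_frechet_smooth: "smooth f \<Longrightarrow> linear (frechet_derivative f (at x))"
  by (simp add: smooth_differentiable linear_frechet_derivative)

lemma smooth_inner_const: "smooth X \<Longrightarrow> smooth (\<lambda>x. X x \<bullet> b)"
  using C_diff_bilinear[OF bounded_bilinear_inner, of _ X "\<lambda>x. b"]
  by (simp add: smooth_def C_diff_const)

lemma smooth_derivative_along [intro]:
  fixes f :: "'a::euclidean_space \<Rightarrow> 'b::real_normed_vector"
  assumes "smooth f" "smooth X"
  shows "smooth (\<lambda>x. frechet_derivative f (at x) (X x))"
proof -
  have "frechet_derivative f (at x) (X x)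
      = (\<Sum>b\<in>Basis. (X x \<bullet> b) *\<^sub>R frechet_derivative f (at x) b)" for x
  proof -
    have "frechet_derivative f (at x) (X x)
        = frechet_derivative f (at x) (\<Sum>b\<in>Basis. (X x \<bullet> b) *\<^sub>R b)"
      by (simp add: euclidean_representation)
    also have "\<dots> = (\<Sum>b\<in>Basis. (X x \<bullet> b) *\<^sub>R frechet_derivative f (at x) b)"
      using linear_frechet_smooth[OF assms(1)]
      by (simp only: linear_sum linear_scale)
    finally show ?thesis .
  qed
  then show ?thesis
    using assms by (auto intro!: smooth_sum smooth_scaleR smooth_inner_const
        smooth_frechet_derivative)
qed

lemma smooth_apply_vf [intro]: "smooth X \<Longrightarrow> smooth \<alpha> \<Longrightarrow> smooth (apply_vf X \<alpha>)"
  unfolding apply_vf_def by auto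

lemma smooth_lie_bracket [intro]: "smooth X \<Longrightarrow> smooth Y \<Longrightarrow> smooth (lie_bracket X Y)"
  unfolding lie_bracket_def by auto

lemma smooth_vf_bracket [intro]:
  assumes "smooth \<omega>" "smooth g" "\<And>x. pairing \<omega> g x \<noteq> 0" "smooth m1" "smooth m2"
  shows "smooth (vf_bracket \<omega> g m1 m2)"
  unfolding vf_bracket_def
  by (intro smooth_diff smooth_add smooth_scaleR smooth_divide smooth_lie_bracket
      smooth_pairing assms)


section \<open>Independence of representatives\<close>

lemma equiv_span_rel: "equiv {m. smooth m} (span_rel g)"
proof (rule equivI)
  show "span_rel g \<subseteq> {m. smooth m} \<times> {m. smooth m}"
    by (auto simp: span_rel_def)
  show "refl_on {m. smooth m} (span_rel g)"
    by (auto simp: span_rel_def refl_on_def intro!: exI[of _ "\<lambda>x. 0"])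
  show "sym (span_rel g)"
  proof (rule symI)
    fix m m' assume "(m, m') \<in> span_rel g"
    then obtain \<alpha> where *: "smooth m" "smooth m'" "smooth \<alpha>" "m' = (\<lambda>x. m x + \<alpha> x *\<^sub>R g x)"
      unfolding span_rel_def by blast
    then show "(m', m) \<in> span_rel g"
      by (auto simp: span_rel_def intro!: exI[of _ "\<lambda>x. - \<alpha> x"])
  qed
  show "trans (span_rel g)"
  proof (rule transI)
    fix m m' m'' assume "(m, m') \<in> span_rel g" "(m', m'') \<in> span_rel g"
    then obtain \<alpha> \<beta> where "smooth m" "smooth m''" "smooth \<alpha>" "smooth \<beta>"
        "m' = (\<lambda>x. m x + \<alpha> x *\<^sub>R g x)" "m'' = (\<lambda>x. m' x + \<beta> x *\<^sub>R g x)"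
      unfolding span_rel_def by blast
    then show "(m, m'') \<in> span_rel g"
      by (auto simp: span_rel_def scaleR_left_distrib intro!: exI[of _ "\<lambda>x. \<alpha> x + \<beta> x"])
  qed
qed

lemma sec_class_eqI: "(m, m') \<in> span_rel g \<Longrightarrow> sec_class g m = sec_class g m'"
  unfolding sec_class_def by (rule equiv_class_eq[OF equiv_span_rel])

lemma self_in_sec_class: "smooth m \<Longrightarrow> m \<in> sec_class g m"
  unfolding sec_class_def by (rule equiv_class_self[OF equiv_span_rel]) simp

lemma mem_sec_classE:
  assumes "m' \<in> sec_class g m"
  obtains \<alpha> where "smooth m" "smooth \<alpha>" "m' = (\<lambda>x. m x + \<alpha> x *\<^sub>R g x)"
  using assms by (auto simp: sec_class_def span_rel_def)

lemma span_relI: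
  assumes "smooth m" "smooth g" "smooth \<alpha>" "\<And>x. m' x = m x + \<alpha> x *\<^sub>R g x"
  shows "(m, m') \<in> span_rel g"
proof -
  have "m' = (\<lambda>x. m x + \<alpha> x *\<^sub>R g x)" using assms(4) by blast
  then show ?thesis using assms(1-3) unfolding span_rel_def by auto
qed

lemma sec_add_class:
  assumes "smooth g" "smooth m" "smooth n"
  shows "sec_add g (sec_class g m) (sec_class g n) = sec_class g (\<lambda>x. m x + n x)"
proof -
  have "sec_class g (\<lambda>x. m' x + n' x) = sec_class g (\<lambda>x. m x + n x)"
    if m': "m' \<in> sec_class g m" and n': "n' \<in> sec_class g n" for m' n'
  proof -
    obtain \<alpha> where a: "smooth \<alpha>" "m' = (\<lambda>x. m x + \<alpha> x *\<^sub>R g x)"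
      using m' by (rule mem_sec_classE)
    obtain \<beta> where b: "smooth \<beta>" "n' = (\<lambda>x. n x + \<beta> x *\<^sub>R g x)"
      using n' by (rule mem_sec_classE)
    show ?thesis
      by (rule sec_class_eqI[symmetric], rule span_relI[where \<alpha> = "\<lambda>x. \<alpha> x + \<beta> x"])
        (use assms a b in \<open>auto simp: algebra_simps\<close>)
  qed
  then have "sec_add g (sec_class g m) (sec_class g n)
      = (\<Union>m'\<in>sec_class g m. \<Union>n'\<in>sec_class g n. sec_class g (\<lambda>x. m x + n x))"
    unfolding sec_add_def by (intro SUP_cong refl)
  then show ?thesis
    using self_in_sec_class[OF assms(2), of g] self_in_sec_class[OF assms(3), of g] by auto
qed

lemma sec_scale_class:
  assumes "smooth g" "smooth \<alpha>" "smooth m"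
  shows "sec_scale g \<alpha> (sec_class g m) = sec_class g (\<lambda>x. \<alpha> x *\<^sub>R m x)"
proof -
  have "sec_class g (\<lambda>x. \<alpha> x *\<^sub>R m' x) = sec_class g (\<lambda>x. \<alpha> x *\<^sub>R m x)"
    if m': "m' \<in> sec_class g m" for m'
  proof -
    obtain \<beta> where b: "smooth \<beta>" "m' = (\<lambda>x. m x + \<beta> x *\<^sub>R g x)"
      using m' by (rule mem_sec_classE)
    show ?thesis
      by (rule sec_class_eqI[symmetric], rule span_relI[where \<alpha> = "\<lambda>x. \<alpha> x * \<beta> x"])
        (use assms b in \<open>auto simp: algebra_simps\<close>)
  qed
  then have "sec_scale g \<alpha> (sec_class g m)
      = (\<Union>m'\<in>sec_class g m. sec_class g (\<lambda>x. \<alpha> x *\<^sub>R m x))"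
    unfolding sec_scale_def by (intro SUP_cong refl)
  then show ?thesis
    using self_in_sec_class[OF assms(3), of g] by auto
qed

lemma vf_anchor_shift:
  assumes "\<And>x. pairing \<omega> g x \<noteq> 0"
  shows "vf_anchor \<omega> g (\<lambda>x. m x + \<alpha> x *\<^sub>R g x) = vf_anchor \<omega> g m"
  using assms
  by (auto simp: vf_anchor_def pairing_def blinfun.add_right blinfun.scaleR_right
      add_divide_distrib scaleR_left_distrib fun_eq_iff)

lemma sec_anchor_class:
  assumes "\<And>x. pairing \<omega> g x \<noteq> 0" "smooth m"
  shows "sec_anchor \<omega> g (sec_class g m) = vf_anchor \<omega> g m"
proof -
  have "vf_anchor \<omega> g ` sec_class g m = {vf_anchor \<omega> g m}"
  proof -
    have "vf_anchor \<omega> g m' = vf_anchor \<omega> g m" if "m' \<in> sec_class g m" for m'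
      using that vf_anchor_shift[OF assms(1)] by (elim mem_sec_classE) simp
    then show ?thesis using self_in_sec_class[OF assms(2)] by blast
  qed
  then show ?thesis by (simp add: sec_anchor_def)
qed

lemma lie_bracket_skew: "lie_bracket X Y x = - lie_bracket Y X x"
  by (simp add: lie_bracket_def)

lemma lie_bracket_shift:
  assumes "smooth X" "smooth Y" "smooth \<alpha>" "smooth Z"
  shows "lie_bracket X (\<lambda>x. Y x + \<alpha> x *\<^sub>R Z x) x
    = lie_bracket X Y x + \<alpha> x *\<^sub>R lie_bracket X Z x + apply_vf X \<alpha> x *\<^sub>R Z x"
proof -
  have "((\<lambda>x. Y x + \<alpha> x *\<^sub>R Z x) has_derivative
      (\<lambda>v. frechet_derivative Y (at x) v
        + (\<alpha> x *\<^sub>R frechet_derivative Z (at x) v + frechet_derivative \<alpha> (at x) v *\<^sub>R Z x))) (at x)"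
    by (intro has_derivative_add has_derivative_scaleR smooth_has_derivative assms)
  from frechet_derivative_at[OF this]
  have "frechet_derivative (\<lambda>x. Y x + \<alpha> x *\<^sub>R Z x) (at x) v
      = frechet_derivative Y (at x) v
        + (\<alpha> x *\<^sub>R frechet_derivative Z (at x) v + frechet_derivative \<alpha> (at x) v *\<^sub>R Z x)" for v
    by (rule fun_cong[symmetric])
  then show ?thesis
    using linear_frechet_smooth[OF assms(1), of x]
    by (simp add: lie_bracket_def apply_vf_def linear_add linear_scale algebra_simps)
qed

lemma vf_bracket_skew: "vf_bracket \<omega> g m1 m2 x = - vf_bracket \<omega> g m2 m1 x"
  using lie_bracket_skew[of m1 m2 x] by (simp add: vf_bracket_def)

lemma lie_bracket_self: "lie_bracket X X x = 0"
  by (simp add: lie_bracket_def)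

lemma vf_bracket_shift_right:
  assumes "smooth g" "\<And>x. pairing \<omega> g x \<noteq> 0" "smooth m1" "smooth m2" "smooth \<beta>"
  shows "vf_bracket \<omega> g m1 (\<lambda>x. m2 x + \<beta> x *\<^sub>R g x) x = vf_bracket \<omega> g m1 m2 x
    + (apply_vf m1 \<beta> x - (pairing \<omega> m1 x / pairing \<omega> g x) * apply_vf g \<beta> x) *\<^sub>R g x"
proof -
  have p: "pairing \<omega> (\<lambda>x. m2 x + \<beta> x *\<^sub>R g x) x / pairing \<omega> g x
      = pairing \<omega> m2 x / pairing \<omega> g x + \<beta> x"
    using assms(2)[of x]
    by (simp add: pairing_def blinfun.add_right blinfun.scaleR_right field_simps)
  show ?thesis
    unfolding vf_bracket_def p
    using assms lie_bracket_skew[of m1 g x]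
    by (simp add: lie_bracket_shift lie_bracket_self algebra_simps)
qed

lemma sec_bracket_class:
  assumes "smooth \<omega>" "smooth g" "\<And>x. pairing \<omega> g x \<noteq> 0" "smooth m1" "smooth m2"
  shows "sec_bracket \<omega> g (sec_class g m1) (sec_class g m2) = sec_class g (vf_bracket \<omega> g m1 m2)"
proof -
  have right: "sec_class g (vf_bracket \<omega> g n1 n2') = sec_class g (vf_bracket \<omega> g n1 n2)"
    if n1: "smooth n1" and mem: "n2' \<in> sec_class g n2" for n1 n2 n2'
  proof -
    obtain \<beta> where b: "smooth n2" "smooth \<beta>" "n2' = (\<lambda>x. n2 x + \<beta> x *\<^sub>R g x)"
      using mem by (rule mem_sec_classE)
    have "smooth (\<lambda>x. apply_vf n1 \<beta> x - (pairing \<omega> n1 x / pairing \<omega> g x) * apply_vf g \<beta> x)"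
      using assms n1 b
      by (intro smooth_diff smooth_mult smooth_divide smooth_apply_vf smooth_pairing) auto
    then show ?thesis
      using assms n1 b vf_bracket_shift_right[of g \<omega> n1 n2 \<beta>]
      by (intro sec_class_eqI[symmetric] span_relI) auto
  qed
  have left: "sec_class g (vf_bracket \<omega> g n1' n2) = sec_class g (vf_bracket \<omega> g n1 n2)"
    if n2: "smooth n2" and mem: "n1' \<in> sec_class g n1" for n1 n2 n1'
  proof -
    obtain \<beta> where b: "smooth n1" "smooth \<beta>" "n1' = (\<lambda>x. n1 x + \<beta> x *\<^sub>R g x)"
      using mem by (rule mem_sec_classE)
    let ?c = "\<lambda>x. apply_vf n2 \<beta> x - (pairing \<omega> n2 x / pairing \<omega> g x) * apply_vf g \<beta> x"
    have c: "smooth (\<lambda>x. - ?c x)"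
      using assms n2 b
      by (intro smooth_minus smooth_diff smooth_mult smooth_divide smooth_apply_vf smooth_pairing) auto
    have "vf_bracket \<omega> g n1' n2 x = vf_bracket \<omega> g n1 n2 x + (- ?c x) *\<^sub>R g x" for x
      unfolding vf_bracket_skew[of \<omega> g _ n2] b(3)
      using assms n2 b by (subst vf_bracket_shift_right) (auto simp: scaleR_left_diff_distrib)
    then show ?thesis
      using assms n2 b c
      by (intro sec_class_eqI[symmetric] span_relI[OF _ _ c]) auto
  qed
  have "sec_class g (vf_bracket \<omega> g n1 n2) = sec_class g (vf_bracket \<omega> g m1 m2)"
    if "n1 \<in> sec_class g m1" "n2 \<in> sec_class g m2" for n1 n2
  proof -
    have "smooth n2" using that(2) by (auto simp: sec_class_def span_rel_def)
    then show ?thesis using left[of n2 n1 m1] right[of m1 n2 m2] that assms by simp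
  qed
  then have "sec_bracket \<omega> g (sec_class g m1) (sec_class g m2)
      = (\<Union>n1\<in>sec_class g m1. \<Union>n2\<in>sec_class g m2. sec_class g (vf_bracket \<omega> g m1 m2))"
    unfolding sec_bracket_def by (intro SUP_cong refl)
  then show ?thesis
    using self_in_sec_class[OF assms(4), of g] self_in_sec_class[OF assms(5), of g] by auto
qed

end

theory Submission
  imports Defs
begin

text \<open>The identity already holds exactly for representatives \<open>m1\<close>,
  \<open>m2\<close>, with no correction along \<open>g\<close>. Replacing \<open>m2\<close> by
  \<alpha> times \<open>m2\<close>, the Leibniz rule (\<open>lie_bracket_scale\<close>) makes
  [m1, m2] produce the extra term m1(\<alpha>) m2 and [g, m2] produce g(\<alpha>) m2, while the
  coefficient of [g, m1] is merely multiplied by \<alpha>. The extra terms add up to (m1(\<alpha>) -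
  \<omega>(m1)/\<omega>(g) g(\<alpha>)) m2, whose coefficient is the anchor of \<open>m1\<close>
  applied to \<alpha> (\<open>apply_vf_anchor\<close>, \<open>vf_bracket_scale\<close>). Since all
  operations on sections can be computed on representatives, the identity descends to
  classes.\<close>

lemma lie_bracket_scale:
  assumes "smooth X" "smooth \<alpha>" "smooth Y"
  shows "lie_bracket X (\<lambda>x. \<alpha> x *\<^sub>R Y x) x
    = \<alpha> x *\<^sub>R lie_bracket X Y x + apply_vf X \<alpha> x *\<^sub>R Y x"
proof -
  \<comment> \<open>The Leibniz rule is \<open>lie_bracket_shift\<close> with the zero field as
    base, so the leftover bracket with zero must vanish.\<close>
  have "lie_bracket X (\<lambda>x. 0) x = 0"
    using linear_0[OF linear_frechet_smooth[OF assms(1), of x]]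
    by (simp add: lie_bracket_def)
  then show ?thesis
    using lie_bracket_shift[OF assms(1) smooth_const[of 0] assms(2,3), of x] by simp
qed

text \<open>The derivative of \<alpha> at a point is linear in the direction. The right-hand side is
  the form in which the coefficient of \<open>m2\<close> arises from the Leibniz rule.\<close>

lemma apply_vf_anchor:
  assumes "smooth \<alpha>"
  shows "apply_vf (vf_anchor \<omega> g m) \<alpha> x
    = apply_vf m \<alpha> x - (pairing \<omega> m x / pairing \<omega> g x) * apply_vf g \<alpha> x"
  using linear_frechet_smooth[OF assms, of x]
  by (simp add: apply_vf_def vf_anchor_def linear_diff linear_scale)

lemma smooth_vf_anchor:
  assumes "smooth \<omega>" "smooth g" "\<And>x. pairing \<omega> g x \<noteq> 0" "smooth m"
  shows "smooth (vf_anchor \<omega> g m)"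
  unfolding vf_anchor_def
  by (intro smooth_diff smooth_scaleR smooth_divide smooth_pairing assms)

text \<open>Only the brackets with \<open>m2\<close> as an argument differentiate \<alpha>; in the
  remaining one, \<open>m2\<close> enters through \<open>pairing\<close>, which is linear over
  functions.\<close>

lemma vf_bracket_scale:
  assumes "smooth g" "smooth m1" "smooth \<alpha>" "smooth m2"
  shows "vf_bracket \<omega> g m1 (\<lambda>x. \<alpha> x *\<^sub>R m2 x) x
    = \<alpha> x *\<^sub>R vf_bracket \<omega> g m1 m2 x + apply_vf (vf_anchor \<omega> g m1) \<alpha> x *\<^sub>R m2 x"
proof -
  have "pairing \<omega> (\<lambda>x. \<alpha> x *\<^sub>R m2 x) x = \<alpha> x * pairing \<omega> m2 x"
    by (simp add: pairing_def blinfun.scaleR_right)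
  then show ?thesis
    by (simp add: vf_bracket_def lie_bracket_scale assms apply_vf_anchor algebra_simps)
qed

lemma sectionsE:
  assumes "M \<in> sections g"
  obtains m where "smooth m" "M = sec_class g m"
  using assms unfolding sections_def sec_class_def by (auto elim: quotientE)

theorem lemma9:
  fixes g :: "real^'n::finite \<Rightarrow> real^'n"
    and \<omega> :: "real^'n \<Rightarrow> ((real^'n) \<Rightarrow>\<^sub>L real)"
    and M1 M2 :: "(real^'n \<Rightarrow> real^'n) set"
    and \<alpha> :: "real^'n \<Rightarrow> real"
  assumes "smooth g"
    and "smooth \<omega>"
    and "\<forall>x. pairing \<omega> g x \<noteq> 0"
    and "\<forall>x u v w. wedge_2_1 (ext_deriv \<omega>) \<omega> x u v w = 0"
    and "M1 \<in> sections g"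
    and "M2 \<in> sections g"
    and "smooth \<alpha>"
  shows "sec_bracket \<omega> g M1 (sec_scale g \<alpha> M2) =
    sec_add g (sec_scale g \<alpha> (sec_bracket \<omega> g M1 M2))
      (sec_scale g (apply_vf (sec_anchor \<omega> g M1) \<alpha>) M2)"
proof -
  obtain m1 where m1: "smooth m1" "M1 = sec_class g m1"
    using \<open>M1 \<in> sections g\<close> by (rule sectionsE)
  obtain m2 where m2: "smooth m2" "M2 = sec_class g m2"
    using \<open>M2 \<in> sections g\<close> by (rule sectionsE)
  have nz: "\<And>x. pairing \<omega> g x \<noteq> 0" using assms(3) by simp
  note g = \<open>smooth g\<close> and \<omega> = \<open>smooth \<omega>\<close> and \<alpha> = \<open>smooth \<alpha>\<close>
  let ?a = "apply_vf (vf_anchor \<omega> g m1) \<alpha>"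
  \<comment> \<open>Evaluating scaling and addition on representatives requires smooth coefficients
    and fields, hence this fact and the next.\<close>
  have a: "smooth ?a"
    by (intro smooth_apply_vf smooth_vf_anchor g \<omega> \<alpha> nz m1)
  have b: "smooth (vf_bracket \<omega> g m1 m2)"
    by (rule smooth_vf_bracket[OF \<omega> g nz m1(1) m2(1)])
  have "sec_bracket \<omega> g M1 (sec_scale g \<alpha> M2)
      = sec_class g (vf_bracket \<omega> g m1 (\<lambda>x. \<alpha> x *\<^sub>R m2 x))"
    unfolding m1(2) m2(2) sec_scale_class[OF g \<alpha> m2(1)]
    by (rule sec_bracket_class[OF \<omega> g nz m1(1) smooth_scaleR[OF \<alpha> m2(1)]])
  \<comment> \<open>The two representatives are equal as vector fields, so congruence
    suffices.\<close>
  also have "\<dots> = sec_class g (\<lambda>x. \<alpha> x *\<^sub>R vf_bracket \<omega> g m1 m2 x + ?a x *\<^sub>R m2 x)"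
    by (rule arg_cong[where f = "sec_class g"], rule ext,
        rule vf_bracket_scale[OF g m1(1) \<alpha> m2(1)])
  also have "\<dots> = sec_add g (sec_class g (\<lambda>x. \<alpha> x *\<^sub>R vf_bracket \<omega> g m1 m2 x))
      (sec_class g (\<lambda>x. ?a x *\<^sub>R m2 x))"
    by (rule sec_add_class[symmetric, OF g smooth_scaleR[OF \<alpha> b] smooth_scaleR[OF a m2(1)]])
  also have "\<dots> = sec_add g (sec_scale g \<alpha> (sec_bracket \<omega> g M1 M2))
      (sec_scale g (apply_vf (sec_anchor \<omega> g M1) \<alpha>) M2)"
    unfolding m1(2) m2(2) sec_anchor_class[OF nz m1(1)]
      sec_bracket_class[OF \<omega> g nz m1(1) m2(1)]
      sec_scale_class[OF g \<alpha> b] sec_scale_class[OF g a m2(1)] ..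
  finally show ?thesis .
qed

end
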